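(* Let $a,b\in\mathbb{N}$ with $a\le b$, and let $\mathcal{C}_0=\mathcal{C}_0(a,b)$. Then $\mathcal{C}_0$ is cyclic if and only if $a\in\{1,2\}$ or $\gcd(a,b)=1$.
   Context: $\mathbb{N}$ denotes the positive integers. For $a,b\in\mathbb{N}$ with $a\le b$, let $\Omega=\{1,\ldots,a\}\times\{1,\ldots,b\}$ and let $\mathcal{V}=\operatorname{Mat}(a,b,\mathbb{F}_2)$ be the $\mathbb{F}_2$-vector space of $a\times b$ matrices, with standard basis the elementary matrices $\mathbf{e}_{ij}$, $(i,j)\in\Omega$. Define $\mathbf{r}_i=\sum_{j=1}^b\mathbf{e}_{ij}$ ($1\le i\le a$) and $\mathbf{c}_j=\sum_{i=1}^a\mathbf{e}_{ij}$ ($1\le j\le b$), and let $\mathcal{C}_0(a,b)\le\mathcal{V}$ be the $\mathbb{F}_2$-span of $\{\mathbf{r}_1,\ldots,\mathbf{r}_a,\mathbf{c}_1,\ldots,\mathbf{c}_b\}$. For a subspace $\mathcal{C}\le\mathcal{V}$, $\operatorname{Aut}(\mathcal{C})\le\operatorname{Sym}(\Omega)$ is the group of all permutations of $\Omega$ whose induced permutation of the standard basis maps $\mathcal{C}$ into itself. The code $\mathcal{C}$ is cyclic if $\operatorname{Aut}(\mathcal{C})$ contains a cyclic subgroup acting regularly on $\Omega$ (equivalently, a single cycle of length $ab$). *)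

theory Defs
  imports
    Complex_Main
    "HOL-Library.Z2"
    "HOL-Library.Function_Algebras"
    "HOL-Algebra.Bij"
    "HOL-Algebra.Elementary_Groups"
begin

definition \<Omega> :: "nat \<Rightarrow> nat \<Rightarrow> (nat \<times> nat) set" where
  "\<Omega> a b = {1..a} \<times> {1..b}"

text \<open>
  The field with two elements is the type \<^typ>\<open>bit\<close>. An a-by-b matrix over it is a function on
  \<^typ>\<open>nat \<times> nat\<close> that vanishes outside \<open>\<Omega> a b\<close>; these matrices form a subspace of the space of
  all functions, so spans may be taken in the latter.
\<close>

definition scale :: "bit \<Rightarrow> (nat \<times> nat \<Rightarrow> bit) \<Rightarrow> (nat \<times> nat \<Rightarrow> bit)" where
  "scale k v = (\<lambda>\<omega>. k * v \<omega>)"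

global_interpretation F2: vector_space scale
  by unfold_locales (auto simp: scale_def fun_eq_iff algebra_simps)

definition Mat :: "nat \<Rightarrow> nat \<Rightarrow> (nat \<times> nat \<Rightarrow> bit) set" where
  "Mat a b = {v. \<forall>\<omega>. \<omega> \<notin> \<Omega> a b \<longrightarrow> v \<omega> = 0}"

definition elem_mat :: "nat \<times> nat \<Rightarrow> (nat \<times> nat \<Rightarrow> bit)" where
  "elem_mat \<omega> = (\<lambda>\<omega>'. if \<omega>' = \<omega> then 1 else 0)"

definition row_vec :: "nat \<Rightarrow> nat \<Rightarrow> (nat \<times> nat \<Rightarrow> bit)" where
  "row_vec b i = (\<Sum>j=1..b. elem_mat (i, j))"

definition col_vec :: "nat \<Rightarrow> nat \<Rightarrow> (nat \<times> nat \<Rightarrow> bit)" where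
  "col_vec a j = (\<Sum>i=1..a. elem_mat (i, j))"

definition C0 :: "nat \<Rightarrow> nat \<Rightarrow> (nat \<times> nat \<Rightarrow> bit) set" where
  "C0 a b = F2.span (row_vec b ` {1..a} \<union> col_vec a ` {1..b})"

text \<open>The linear map on matrices that permutes the standard basis by sending the basis vector
  at \<open>\<omega>\<close> to the one at \<open>p \<omega>\<close>.\<close>

definition perm_map :: "nat \<Rightarrow> nat \<Rightarrow> (nat \<times> nat \<Rightarrow> nat \<times> nat) \<Rightarrow> (nat \<times> nat \<Rightarrow> bit) \<Rightarrow> (nat \<times> nat \<Rightarrow> bit)" where
  "perm_map a b p v = (\<Sum>\<omega>\<in>\<Omega> a b. scale (v \<omega>) (elem_mat (p \<omega>)))"

definition Aut :: "nat \<Rightarrow> nat \<Rightarrow> (nat \<times> nat \<Rightarrow> bit) set \<Rightarrow> (nat \<times> nat \<Rightarrow> nat \<times> nat) set" where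
  "Aut a b C = {p \<in> carrier (BijGroup (\<Omega> a b)). perm_map a b p ` C \<subseteq> C}"

definition acts_regularly :: "('x \<Rightarrow> 'x) set \<Rightarrow> 'x set \<Rightarrow> bool" where
  "acts_regularly H S \<longleftrightarrow> (\<forall>x\<in>S. \<forall>y\<in>S. \<exists>!h. h \<in> H \<and> h x = y)"

definition cyclic_code :: "nat \<Rightarrow> nat \<Rightarrow> (nat \<times> nat \<Rightarrow> bit) set \<Rightarrow> bool" where
  "cyclic_code a b C \<longleftrightarrow>
     (\<exists>H. subgroup H (BijGroup (\<Omega> a b)) \<and> H \<subseteq> Aut a b C \<and>
          cyclic_group (BijGroup (\<Omega> a b)\<lparr>carrier := H\<rparr>) \<and>
          acts_regularly H (\<Omega> a b))"

lemma subspace_Mat: "F2.subspace (Mat a b)"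
  by (auto simp: F2.subspace_def Mat_def scale_def)

lemma sum_fun_apply: "(\<Sum>i\<in>I. f i) x = (\<Sum>i\<in>I. f i x)"
  for f :: "'i \<Rightarrow> 'x \<Rightarrow> bit"
  by (induction I rule: infinite_finite_induct) auto

lemma C0_subset_Mat: "C0 a b \<subseteq> Mat a b"
  unfolding C0_def
proof (rule F2.span_minimal[OF _ subspace_Mat])
  show "row_vec b ` {1..a} \<union> col_vec a ` {1..b} \<subseteq> Mat a b"
    by (auto simp: row_vec_def col_vec_def Mat_def \<Omega>_def sum_fun_apply elem_mat_def
             intro!: sum.neutral)
qed

lemma perm_map_elem_mat: "\<omega> \<in> \<Omega> a b \<Longrightarrow> perm_map a b p (elem_mat \<omega>) = elem_mat (p \<omega>)"
proof -
  assume w: "\<omega> \<in> \<Omega> a b"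
  have "perm_map a b p (elem_mat \<omega>) = (\<Sum>\<omega>'\<in>\<Omega> a b. if \<omega>' = \<omega> then elem_mat (p \<omega>') else 0)"
    unfolding perm_map_def by (rule sum.cong) (auto simp: scale_def elem_mat_def fun_eq_iff)
  also have "\<dots> = elem_mat (p \<omega>)"
    using w by (simp add: \<Omega>_def)
  finally show ?thesis .
qed

end

theory Submission
  imports Defs "HOL-Algebra.Multiplicative_Group" "HOL-Number_Theory.Cong"
begin

text \<open>
  A matrix lies in \<open>C0 a b\<close> iff its entries have the form \<open>x i + y j\<close> (\<open>C0_iff\<close>), so \<open>C0 a b\<close> is
  the cut space of the complete bipartite graph whose edges are the cells of the grid. Its dual is
  the cycle space, and the words of weight four in the dual are the 4-cycles of the graph, that is,
  the corner sets of the rectangles in the grid. The theorem says when the permutations that respect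
  this structure include a single cycle through all cells.

  Let \<open>3 \<le> a \<le> b\<close>. Two cells that are neither in one row nor in one column lie on exactly one common
  rectangle, while two cells of a row lie on \<open>a - 1 \<ge> 2\<close> and two cells of a column on \<open>b - 1 \<ge> 2\<close>
  common rectangles. An automorphism permutes the rectangles, hence keeps cells on a common line on a
  common line (\<open>Aut_preserves_aligned\<close>). Such a permutation maps lines to lines, so it is either
  \<open>(i, j) \<mapsto> (\<sigma> i, \<tau> j)\<close> or, for \<open>a = b\<close>, \<open>(i, j) \<mapsto> (\<tau> j, \<sigma> i)\<close>
  (\<open>grid_automorphism_cases\<close>). If it is transitive on cells, then in the first case \<open>\<sigma>\<close> and \<open>\<tau>\<close> are
  cycles of lengths \<open>a\<close> and \<open>b\<close>, so orbits have length at most \<open>lcm a b\<close>, which forces \<open>gcd a b = 1\<close>.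
  In the second case the cells \<open>(i, \<sigma> i)\<close> are permuted by the square of the map, and there are only
  \<open>a\<close> of them, so the orbit length \<open>a\<^sup>2\<close> is at most \<open>2 a\<close>, contradicting \<open>a \<ge> 3\<close>.

  Conversely, if \<open>gcd a b = 1\<close>, the product of an \<open>a\<close>-cycle on rows and a \<open>b\<close>-cycle on columns is a
  single cycle by the Chinese remainder theorem. For \<open>a = 2\<close>, exchanging the two entries of a column
  adds \<open>x 1 + x 2\<close> to both of them, which is the effect of changing \<open>y j\<close>; so such exchanges are
  automorphisms, and rotating the columns with one exchange per turn gives a cycle of length \<open>2 b\<close>.
\<close>

(* These rules turn sums and products over the two-element field into boolean operations and so
   keep the ring laws from applying. *)
declare add_bit_eq_xor [simp del] mult_bit_eq_and [simp del]

section \<open>Powers of a map and their orbits\<close>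

lemma funpow_mem: "f ` S \<subseteq> S \<Longrightarrow> x \<in> S \<Longrightarrow> (f ^^ k) x \<in> S"
  by (induction k) auto

lemma funpow_mult_fixed: "(f ^^ d) x = x \<Longrightarrow> (f ^^ (d * m)) x = x"
  by (induction m) (simp_all add: funpow_add)

text \<open>By the pigeonhole principle two of the first \<open>card S + 1\<close> iterates agree, and injectivity
  lets the earlier one be cancelled.\<close>

lemma inj_on_returns:
  assumes "finite S" "f ` S \<subseteq> S" "inj_on f S" "x \<in> S"
  shows "\<exists>d. 0 < d \<and> d \<le> card S \<and> (f ^^ d) x = x"
proof -
  have mem: "(f ^^ k) x \<in> S" for k
    using assms by (intro funpow_mem)
  have "card ((\<lambda>k. (f ^^ k) x) ` {..card S}) \<le> card S"
    using mem assms(1) by (intro card_mono) auto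
  then have "\<not> inj_on (\<lambda>k. (f ^^ k) x) {..card S}"
    by (metis card_atMost card_image not_less_eq_eq order_refl)
  then obtain m n where "m \<noteq> n" "m \<le> card S" "n \<le> card S" "(f ^^ m) x = (f ^^ n) x"
    unfolding inj_on_def by auto
  then obtain m n where mn: "m < n" "n \<le> card S" "(f ^^ m) x = (f ^^ n) x"
    by (metis linorder_neqE_nat)
  have "bij_betw f S S"
    using assms by (simp add: bij_betw_def endo_inj_surj)
  then have "inj_on (f ^^ m) S"
    using bij_betw_funpow bij_betw_def by blast
  moreover have "(f ^^ m) ((f ^^ (n - m)) x) = (f ^^ m) x"
    using mn by (simp flip: funpow_add[unfolded o_def fun_eq_iff, rule_format])
  ultimately have "(f ^^ (n - m)) x = x"
    using mem assms(4) by (meson inj_onD)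
  with mn show ?thesis by (intro exI[of _ "n - m"]) auto
qed

text \<open>The converse bound: a return after \<open>d\<close> steps leaves only \<open>d\<close> iterates, so a transitive map
  cannot return early.\<close>

lemma orbit_card_le_period:
  assumes "0 < d" "(f ^^ d) x = x" "\<And>y. y \<in> S \<Longrightarrow> \<exists>k. (f ^^ k) x = y"
  shows "card S \<le> d"
proof -
  have "(f ^^ k) x = (f ^^ (k mod d)) x" for k
  proof -
    have "(f ^^ k) x = (f ^^ (k mod d + d * (k div d))) x" by simp
    also have "\<dots> = (f ^^ (k mod d)) x"
      using funpow_mult_fixed[OF assms(2)] by (simp only: funpow_add o_def)
    finally show ?thesis .
  qed
  then have "S \<subseteq> (\<lambda>k. (f ^^ k) x) ` {..<d}"
    using assms(1,3) by (metis (no_types, lifting) image_eqI lessThan_iff mod_less_divisor subsetI)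
  then show ?thesis
    by (metis card_image_le card_lessThan card_mono finite_imageI finite_lessThan le_trans)
qed

section \<open>Cyclic codes in terms of a single permutation\<close>

lemma finite_\<Omega> [simp]: "finite (\<Omega> a b)"
  and card_\<Omega> [simp]: "card (\<Omega> a b) = a * b"
  and mem_\<Omega> [simp]: "(i, j) \<in> \<Omega> a b \<longleftrightarrow> i \<in> {1..a} \<and> j \<in> {1..b}"
  by (auto simp: \<Omega>_def)

text \<open>Permuting the basis by \<open>p\<close> amounts to composing matrices with the inverse of \<open>p\<close>.\<close>

lemma perm_map_apply:
  assumes "bij_betw p (\<Omega> a b) (\<Omega> a b)" "\<omega> \<in> \<Omega> a b"
  shows "perm_map a b p v (p \<omega>) = v \<omega>"
proof -
  have "perm_map a b p v (p \<omega>) = (\<Sum>\<omega>'\<in>\<Omega> a b. if \<omega>' = \<omega> then v \<omega>' else 0)"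
    unfolding perm_map_def sum_fun_apply
    using assms by (intro sum.cong) (auto simp: scale_def elem_mat_def bij_betw_def inj_on_def)
  then show ?thesis using assms(2) by simp
qed

lemma perm_map_in_Mat:
  assumes "bij_betw p (\<Omega> a b) (\<Omega> a b)"
  shows "perm_map a b p v \<in> Mat a b"
proof -
  have "perm_map a b p v \<omega> = 0" if "\<omega> \<notin> \<Omega> a b" for \<omega>
  proof -
    have "p \<omega>' \<noteq> \<omega>" if "\<omega>' \<in> \<Omega> a b" for \<omega>'
      using assms that \<open>\<omega> \<notin> \<Omega> a b\<close> by (auto simp: bij_betw_def)
    then show ?thesis
      unfolding perm_map_def sum_fun_apply
      by (intro sum.neutral) (auto simp: scale_def elem_mat_def)
  qed
  then show ?thesis by (simp add: Mat_def del: split_paired_All)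
qed

lemma perm_map_comp:
  assumes "bij_betw q (\<Omega> a b) (\<Omega> a b)"
  shows "perm_map a b (p \<circ> q) v = perm_map a b p (perm_map a b q v)"
proof -
  have "perm_map a b p (perm_map a b q v) =
      (\<Sum>\<omega>\<in>\<Omega> a b. scale (perm_map a b q v (q \<omega>)) (elem_mat (p (q \<omega>))))"
    unfolding perm_map_def[of a b p]
    by (rule sum.reindex_bij_betw[OF assms, symmetric])
  also have "\<dots> = perm_map a b (p \<circ> q) v"
    unfolding perm_map_def[of a b "p \<circ> q"]
    by (intro sum.cong) (simp_all add: perm_map_apply[OF assms])
  finally show ?thesis ..
qed

lemma perm_map_cong:
  "(\<And>\<omega>. \<omega> \<in> \<Omega> a b \<Longrightarrow> p \<omega> = q \<omega>) \<Longrightarrow> perm_map a b p v = perm_map a b q v"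
  unfolding perm_map_def by (intro sum.cong) auto

lemma perm_map_id:
  assumes "v \<in> Mat a b"
  shows "perm_map a b id v = v"
proof
  fix \<omega>
  have "bij_betw id (\<Omega> a b) (\<Omega> a b)" by (simp add: bij_betw_def)
  then show "perm_map a b id v \<omega> = v \<omega>"
    using perm_map_apply[of id a b \<omega> v] perm_map_in_Mat[of id a b v] assms
    by (cases "\<omega> \<in> \<Omega> a b") (simp_all add: Mat_def del: split_paired_All)
qed

lemma perm_map_funpow:
  assumes "bij_betw h (\<Omega> a b) (\<Omega> a b)" "perm_map a b h ` C \<subseteq> C" "C \<subseteq> Mat a b"
  shows "perm_map a b (h ^^ k) ` C \<subseteq> C"
proof (induction k)
  case 0
  then show ?case using assms(3) perm_map_id by (auto simp flip: id_def)
next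
  case (Suc k)
  have "perm_map a b (h ^^ Suc k) v = perm_map a b h (perm_map a b (h ^^ k) v)" for v
    using perm_map_comp[OF bij_betw_funpow[OF assms(1)], of h] by simp
  then show ?case using Suc assms(2) by (simp add: image_subset_iff del: funpow.simps)
qed

lemma BijGroup_simps [simp]:
  "carrier (BijGroup S) = Bij S" "\<one>\<^bsub>BijGroup S\<^esub> = (\<lambda>x\<in>S. x)"
  by (simp_all add: BijGroup_def)

lemma BijGroup_mult_apply:
  "p \<in> Bij S \<Longrightarrow> q \<in> Bij S \<Longrightarrow> x \<in> S \<Longrightarrow> (p \<otimes>\<^bsub>BijGroup S\<^esub> q) x = p (q x)"
  by (simp add: BijGroup_def compose_def)

lemma BijGroup_pow_apply:
  assumes "p \<in> Bij S" "x \<in> S"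
  shows "(p [^]\<^bsub>BijGroup S\<^esub> (k::nat)) x = (p ^^ k) x"
proof -
  interpret group "BijGroup S" by (rule group_BijGroup)
  show ?thesis
    using assms(2)
  proof (induction k arbitrary: x)
    case (Suc k)
    moreover have "p x \<in> S" using assms(1) Suc.prems by (auto simp: Bij_def bij_betw_def)
    moreover have "p [^]\<^bsub>BijGroup S\<^esub> k \<in> Bij S"
      using nat_pow_closed[of p k] assms(1) by simp
    ultimately show ?case
      using assms(1) by (simp add: BijGroup_mult_apply funpow_swap1)
  qed simp
qed

lemma finite_Bij: "finite S \<Longrightarrow> finite (Bij S)"
  by (rule finite_subset[OF _ finite_PiE[of S "\<lambda>_. S"]])
     (auto simp: Bij_def bij_betw_def PiE_def)

text \<open>
  The regular group is the one generated by \<open>h\<close>. As the ground set is finite, every element of it is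
  a power with natural exponent, and it preserves the code because \<open>h\<close> does.
  Transitive commutative groups act freely: two powers that agree at one cell agree at
  every cell, because any other cell is reached by a further power, which commutes with both.
\<close>

lemma cyclic_codeI:
  assumes h: "bij_betw h (\<Omega> a b) (\<Omega> a b)" and C: "perm_map a b h ` C \<subseteq> C" "C \<subseteq> Mat a b"
    and x: "x \<in> \<Omega> a b" and trans: "\<And>y. y \<in> \<Omega> a b \<Longrightarrow> \<exists>k. (h ^^ k) x = y"
  shows "cyclic_code a b C"
proof -
  let ?S = "\<Omega> a b"
  let ?G = "BijGroup ?S"
  interpret group ?G by (rule group_BijGroup)
  (* The elements of the group of bijections are undefined off the grid, which h need not be. *)
  define p where "p = restrict h ?S"
  have p: "p \<in> Bij ?S"
    using h by (auto simp: p_def Bij_def cong: bij_betw_cong)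
  have pow: "(p [^]\<^bsub>?G\<^esub> (k::nat)) y = (h ^^ k) y" if "y \<in> ?S" for k y
  proof -
    have "(p ^^ k) y = (h ^^ k) y \<and> (h ^^ k) y \<in> ?S"
      using h that by (induction k) (auto simp: p_def bij_betw_def)
    then show ?thesis using BijGroup_pow_apply[OF p that] by simp
  qed
  define H where "H = generate ?G {p}"
  have H_eq: "H = {p [^]\<^bsub>?G\<^esub> k | k::nat. True}"
    using generate_pow_on_finite_carrier[of p] p finite_Bij[of ?S] by (auto simp: H_def)
  have sub: "subgroup H ?G"
    unfolding H_def using p by (intro generate_is_subgroup) auto
  have "H \<subseteq> Aut a b C"
  proof
    fix q assume "q \<in> H"
    then obtain k :: nat where k: "q = p [^]\<^bsub>?G\<^esub> k" using H_eq by auto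
    have "perm_map a b q v = perm_map a b (h ^^ k) v" for v
      by (intro perm_map_cong) (simp add: k pow)
    then show "q \<in> Aut a b C"
      using perm_map_funpow[OF h C, of k] nat_pow_closed[of p k] p by (auto simp: Aut_def k)
  qed
  moreover have "cyclic_group (?G\<lparr>carrier := H\<rparr>)"
    using cyclic_group_generated[of p] p by (simp add: subgroup_generated_def H_def)
  moreover have "acts_regularly H ?S"
    unfolding acts_regularly_def
  proof (intro ballI)
    fix y z assume y: "y \<in> ?S" and z: "z \<in> ?S"
    obtain d where d: "0 < d" "(h ^^ d) x = x"
      using inj_on_returns[of ?S h x] h x by (auto simp: bij_betw_def)
    obtain m where m: "(h ^^ m) x = y" using trans y by blast
    obtain n where n: "(h ^^ n) x = z" using trans z by blast
    (* h ^^ d fixes x, so going on from step m to step d * m leads back to x. *)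
    have return: "(h ^^ (d * m - m)) y = x"
    proof -
      have "(h ^^ (d * m - m)) y = (h ^^ (d * m - m + m)) x"
        by (simp add: funpow_add m)
      also have "d * m - m + m = d * m" using d(1) by (cases d) auto
      finally show ?thesis using funpow_mult_fixed[OF d(2)] by simp
    qed
    then have reach: "(h ^^ (n + (d * m - m))) y = z"
      by (simp add: funpow_add n)
    show "\<exists>!q. q \<in> H \<and> q y = z"
    proof (intro ex_ex1I)
      show "\<exists>q. q \<in> H \<and> q y = z"
        using reach pow[OF y, of "n + (d * m - m)"] H_eq by auto
    next
      fix q q' assume "q \<in> H \<and> q y = z" "q' \<in> H \<and> q' y = z"
      then obtain k l :: nat where k: "q = p [^]\<^bsub>?G\<^esub> k" and l: "q' = p [^]\<^bsub>?G\<^esub> l"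
        and kl: "(h ^^ k) y = (h ^^ l) y"
        using H_eq pow[OF y] by fastforce
      have "q \<in> Bij ?S" "q' \<in> Bij ?S"
        using nat_pow_closed[of p] p k l by auto
      moreover have "q w = q' w" if w: "w \<in> ?S" for w
      proof -
        obtain r where "(h ^^ r) x = w" using trans w by blast
        then obtain s where s: "(h ^^ s) y = w"
          using return by (metis comp_apply funpow_add)
        have "(h ^^ k) w = (h ^^ s) ((h ^^ k) y)"
          unfolding s[symmetric] by (metis add.commute comp_apply funpow_add)
        also have "\<dots> = (h ^^ l) w"
          unfolding s[symmetric] kl by (metis add.commute comp_apply funpow_add)
        finally show ?thesis using w by (simp add: k l pow)
      qed
      ultimately show "q = q'"
        by (meson Bij_imp_extensional extensionalityI)
    qed
  qed
  ultimately show ?thesis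
    unfolding cyclic_code_def using sub by blast
qed

text \<open>A generator \<open>h\<close> of the regular group reaches every cell from every cell. Its inverse \<open>g\<close> is kept
  as well, since parity checks are transported along \<open>h\<close> by applying \<open>g\<close> to codewords.\<close>

lemma cyclic_codeE:
  assumes "cyclic_code a b C"
  obtains h g where "h \<in> Aut a b C" "g \<in> Aut a b C" "\<And>x. x \<in> \<Omega> a b \<Longrightarrow> g (h x) = x"
    "\<And>x y. x \<in> \<Omega> a b \<Longrightarrow> y \<in> \<Omega> a b \<Longrightarrow> \<exists>k. (h ^^ k) x = y"
proof -
  let ?S = "\<Omega> a b"
  let ?G = "BijGroup ?S"
  interpret group ?G by (rule group_BijGroup)
  obtain H where H: "subgroup H ?G" "H \<subseteq> Aut a b C"
    and cyc: "cyclic_group (?G\<lparr>carrier := H\<rparr>)" and reg: "acts_regularly H ?S"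
    using assms unfolding cyclic_code_def by blast
  interpret HG: group "?G\<lparr>carrier := H\<rparr>"
    using H(1) by (rule subgroup_imp_group)
  from cyc obtain h where h: "h \<in> H" and
    gen: "subgroup_generated (?G\<lparr>carrier := H\<rparr>) {h} = ?G\<lparr>carrier := H\<rparr>"
    unfolding cyclic_group_def by auto
  have HB: "H \<subseteq> Bij ?S" using subgroup.subset[OF H(1)] by simp
  then have "finite H" using finite_Bij[of ?S] finite_subset by auto
  then have "generate (?G\<lparr>carrier := H\<rparr>) {h} = {h [^]\<^bsub>?G\<^esub> k | k::nat. True}"
    using HG.generate_pow_on_finite_carrier[of h] h by (simp add: nat_pow_consistent[symmetric])
  moreover have "generate (?G\<lparr>carrier := H\<rparr>) {h} = H"
    using arg_cong[OF gen, of carrier] h by (simp add: subgroup_generated_def)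
  ultimately have H_eq: "H = {h [^]\<^bsub>?G\<^esub> k | k::nat. True}" by simp
  have trans: "\<exists>k. (h ^^ k) x = y" if "x \<in> ?S" "y \<in> ?S" for x y
  proof -
    from reg that obtain q where "q \<in> H" "q x = y" unfolding acts_regularly_def by blast
    moreover from this obtain k :: nat where "q = h [^]\<^bsub>?G\<^esub> k"
      using H_eq by blast
    ultimately show ?thesis
      using BijGroup_pow_apply[of h ?S x k] h HB that(1) by (metis subsetD)
  qed
  have "inv\<^bsub>?G\<^esub> h \<in> H" using H(1) h by (rule subgroup.m_inv_closed)
  moreover have "(inv\<^bsub>?G\<^esub> h) (h x) = x" if "x \<in> ?S" for x
  proof -
    have "((inv\<^bsub>?G\<^esub> h) \<otimes>\<^bsub>?G\<^esub> h) x = x"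
      using l_inv[of h] h HB that by auto
    then show ?thesis
      using BijGroup_mult_apply[of "inv\<^bsub>?G\<^esub> h" ?S h x] h HB that calculation by (metis subsetD)
  qed
  ultimately show ?thesis
    using that h H(2) trans by blast
qed

section \<open>The code and its parity checks\<close>

lemma bit_add_self [simp]: "x + x = (0 :: bit)"
  by (cases x) simp_all

lemma row_vec_apply: "row_vec b i (i', j) = (if i' = i \<and> j \<in> {1..b} then 1 else 0)"
  by (auto simp: row_vec_def sum_fun_apply elem_mat_def)

lemma col_vec_apply: "col_vec a j (i, j') = (if j' = j \<and> i \<in> {1..a} then 1 else 0)"
  by (auto simp: col_vec_def sum_fun_apply elem_mat_def)

text \<open>The explicit description of the code: \<open>x i\<close> and \<open>y j\<close> are the coefficients of the \<open>i\<close>-th row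
  vector and the \<open>j\<close>-th column vector.\<close>

lemma C0_iff:
  "v \<in> C0 a b \<longleftrightarrow> v \<in> Mat a b \<and> (\<exists>x y. \<forall>i j. (i, j) \<in> \<Omega> a b \<longrightarrow> v (i, j) = x i + y j)"
proof -
  let ?D = "{v \<in> Mat a b. \<exists>x y. \<forall>i j. (i, j) \<in> \<Omega> a b \<longrightarrow> v (i, j) = x i + y j}"
  have "F2.subspace ?D"
  proof (rule F2.subspaceI)
    show "0 \<in> ?D" using F2.subspace_0[OF subspace_Mat] by (auto intro!: exI[of _ "\<lambda>_. 0"])
  next
    fix u w assume "u \<in> ?D" "w \<in> ?D"
    then obtain x y x' y' where "u \<in> Mat a b" "w \<in> Mat a b"
      "\<forall>i j. (i, j) \<in> \<Omega> a b \<longrightarrow> u (i, j) = x i + y j"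
      "\<forall>i j. (i, j) \<in> \<Omega> a b \<longrightarrow> w (i, j) = x' i + y' j" by auto
    moreover from this
    have "\<forall>i j. (i, j) \<in> \<Omega> a b \<longrightarrow> (u + w) (i, j) = (x i + x' i) + (y j + y' j)"
      by (simp add: ac_simps)
    then have "\<exists>x y. \<forall>i j. (i, j) \<in> \<Omega> a b \<longrightarrow> (u + w) (i, j) = x i + y j"
      by (intro exI)
    ultimately show "u + w \<in> ?D"
      using F2.subspace_add[OF subspace_Mat] by blast
  next
    fix c u assume "u \<in> ?D"
    then obtain x y where "u \<in> Mat a b"
      "\<forall>i j. (i, j) \<in> \<Omega> a b \<longrightarrow> u (i, j) = x i + y j" by auto
    moreover from this
    have "\<forall>i j. (i, j) \<in> \<Omega> a b \<longrightarrow> scale c u (i, j) = c * x i + c * y j"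
      by (simp add: scale_def distrib_left)
    then have "\<exists>x y. \<forall>i j. (i, j) \<in> \<Omega> a b \<longrightarrow> scale c u (i, j) = x i + y j"
      by (intro exI)
    ultimately show "scale c u \<in> ?D"
      using F2.subspace_scale[OF subspace_Mat] by blast
  qed
  moreover have "row_vec b i \<in> ?D" if "i \<in> {1..a}" for i
  proof -
    have "row_vec b i \<in> C0 a b"
      using that unfolding C0_def by (intro F2.span_base) auto
    moreover have "\<forall>i' j'. (i', j') \<in> \<Omega> a b \<longrightarrow>
        row_vec b i (i', j') = (if i' = i then 1 else 0) + 0"
      by (simp add: row_vec_apply)
    then have "\<exists>x y. \<forall>i' j'. (i', j') \<in> \<Omega> a b \<longrightarrow> row_vec b i (i', j') = x i' + y j'"
      by (intro exI)
    ultimately show ?thesis using C0_subset_Mat by blast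
  qed
  moreover have "col_vec a j \<in> ?D" if "j \<in> {1..b}" for j
  proof -
    have "col_vec a j \<in> C0 a b"
      using that unfolding C0_def by (intro F2.span_base) auto
    moreover have "\<forall>i' j'. (i', j') \<in> \<Omega> a b \<longrightarrow>
        col_vec a j (i', j') = 0 + (if j' = j then 1 else 0)"
      by (simp add: col_vec_apply)
    then have "\<exists>x y. \<forall>i' j'. (i', j') \<in> \<Omega> a b \<longrightarrow> col_vec a j (i', j') = x i' + y j'"
      by (intro exI)
    ultimately show ?thesis using C0_subset_Mat by blast
  qed
  ultimately have "C0 a b \<subseteq> ?D"
    unfolding C0_def by (intro F2.span_minimal) auto
  moreover have "v \<in> C0 a b" if "v \<in> ?D"
  proof -
    from that obtain x y where v: "v \<in> Mat a b" "\<And>i j. (i, j) \<in> \<Omega> a b \<Longrightarrow> v (i, j) = x i + y j"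
      by auto
    have "v = (\<Sum>i=1..a. scale (x i) (row_vec b i)) + (\<Sum>j=1..b. scale (y j) (col_vec a j))"
    proof
      fix \<omega> :: "nat \<times> nat"
      obtain i j where \<omega>: "\<omega> = (i, j)" by fastforce
      have "(\<Sum>i'=1..a. scale (x i') (row_vec b i') (i, j)) =
          (\<Sum>i'=1..a. if i' = i then (if j \<in> {1..b} then x i else 0) else 0)"
        by (intro sum.cong) (auto simp: scale_def row_vec_apply)
      moreover have "(\<Sum>j'=1..b. scale (y j') (col_vec a j') (i, j)) =
          (\<Sum>j'=1..b. if j' = j then (if i \<in> {1..a} then y j else 0) else 0)"
        by (intro sum.cong) (auto simp: scale_def col_vec_apply)
      ultimately show "v \<omega> = ((\<Sum>i=1..a. scale (x i) (row_vec b i)) +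
          (\<Sum>j=1..b. scale (y j) (col_vec a j))) \<omega>"
        using v by (auto simp: \<omega> sum_fun_apply Mat_def)
    qed
    also have "\<dots> \<in> C0 a b"
      unfolding C0_def
      by (intro F2.span_add F2.span_sum F2.span_scale F2.span_base) auto
    finally show "v \<in> C0 a b" .
  qed
  ultimately show ?thesis by auto
qed

text \<open>The supports of the words in the dual code.\<close>

definition parity_check :: "nat \<Rightarrow> nat \<Rightarrow> (nat \<times> nat) set \<Rightarrow> bool" where
  "parity_check a b Q \<longleftrightarrow> Q \<subseteq> \<Omega> a b \<and> (\<forall>v\<in>C0 a b. (\<Sum>\<omega>\<in>Q. v \<omega>) = 0)"

text \<open>Summing a codeword \<open>v\<close> over \<open>h ` Q\<close> is summing \<open>v \<circ> h\<close> over \<open>Q\<close>, and \<open>v \<circ> h\<close> is the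
  codeword that the automorphism \<open>g\<close> makes of \<open>v\<close>.\<close>

lemma parity_check_image:
  assumes h: "h \<in> Aut a b (C0 a b)" and g: "g \<in> Aut a b (C0 a b)"
    and gh: "\<And>x. x \<in> \<Omega> a b \<Longrightarrow> g (h x) = x" and Q: "parity_check a b Q"
  shows "parity_check a b (h ` Q)"
  unfolding parity_check_def
proof (intro conjI ballI)
  have hb: "bij_betw h (\<Omega> a b) (\<Omega> a b)" and gb: "bij_betw g (\<Omega> a b) (\<Omega> a b)"
    using h g by (auto simp: Aut_def Bij_def)
  have QO: "Q \<subseteq> \<Omega> a b" using Q by (simp add: parity_check_def)
  show "h ` Q \<subseteq> \<Omega> a b" using QO hb by (auto simp: bij_betw_def)
  fix v assume v: "v \<in> C0 a b"
  have "(\<Sum>\<omega>\<in>h ` Q. v \<omega>) = (\<Sum>\<omega>\<in>Q. v (h \<omega>))"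
    using hb QO by (subst sum.reindex) (auto simp: bij_betw_def intro: inj_on_subset)
  also have "\<dots> = (\<Sum>\<omega>\<in>Q. perm_map a b g v \<omega>)"
  proof (rule sum.cong)
    fix \<omega> assume "\<omega> \<in> Q"
    then have "\<omega> \<in> \<Omega> a b" using QO by auto
    moreover from this have "h \<omega> \<in> \<Omega> a b" using hb by (auto simp: bij_betw_def)
    ultimately show "v (h \<omega>) = perm_map a b g v \<omega>"
      using perm_map_apply[OF gb, of "h \<omega>" v] gh by simp
  qed simp
  also have "\<dots> = 0"
    using Q v g by (auto simp: parity_check_def Aut_def)
  finally show "(\<Sum>\<omega>\<in>h ` Q. v \<omega>) = 0" .
qed

text \<open>Each of \<open>x i\<close>, \<open>x i'\<close>, \<open>y j\<close>, \<open>y j'\<close> occurs twice in the sum over the corners.\<close>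

lemma parity_check_rectangle:
  assumes "i \<in> {1..a}" "i' \<in> {1..a}" "j \<in> {1..b}" "j' \<in> {1..b}" "i \<noteq> i'" "j \<noteq> j'"
  shows "parity_check a b {(i, j), (i, j'), (i', j), (i', j')}"
proof -
  have "(\<Sum>\<omega>\<in>{(i, j), (i, j'), (i', j), (i', j')}. v \<omega>) = 0" if "v \<in> C0 a b" for v
  proof -
    obtain x y where "\<And>i j. (i, j) \<in> \<Omega> a b \<Longrightarrow> v (i, j) = x i + y j"
      using \<open>v \<in> C0 a b\<close> by (auto simp: C0_iff)
    then show ?thesis using assms by (simp add: ac_simps)
  qed
  then show ?thesis using assms by (auto simp: parity_check_def)
qed

text \<open>Orthogonality to a row vector means that a parity check has an even number of cells in that row,
  hence never exactly one. The same holds for columns.\<close>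

lemma parity_check_other_in_row:
  assumes Q: "parity_check a b Q" and ij: "(i, j) \<in> Q"
  shows "\<exists>j'. (i, j') \<in> Q \<and> j' \<noteq> j"
proof (rule ccontr)
  assume "\<not> ?thesis"
  then have only: "j' = j" if "(i, j') \<in> Q" for j' using that by blast
  have QO: "Q \<subseteq> \<Omega> a b" using Q by (simp add: parity_check_def)
  then have "i \<in> {1..a}" using ij by auto
  then have "row_vec b i \<in> C0 a b" unfolding C0_def by (intro F2.span_base) auto
  then have "(\<Sum>\<omega>\<in>Q. row_vec b i \<omega>) = 0" using Q by (auto simp: parity_check_def)
  moreover have "(\<Sum>\<omega>\<in>Q. row_vec b i \<omega>) = (\<Sum>\<omega>\<in>Q. if \<omega> = (i, j) then 1 else 0)"
  proof (rule sum.cong)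
    fix \<omega> assume "\<omega> \<in> Q"
    moreover from this have "\<omega> \<in> \<Omega> a b" using QO by blast
    ultimately show "row_vec b i \<omega> = (if \<omega> = (i, j) then 1 else 0)"
      using only by (cases \<omega>) (auto simp: row_vec_apply)
  qed simp
  moreover have "finite Q" using QO finite_\<Omega> by (rule finite_subset)
  ultimately show False
    using ij by simp
qed

lemma parity_check_other_in_column:
  assumes Q: "parity_check a b Q" and ij: "(i, j) \<in> Q"
  shows "\<exists>i'. (i', j) \<in> Q \<and> i' \<noteq> i"
proof (rule ccontr)
  assume "\<not> ?thesis"
  then have only: "i' = i" if "(i', j) \<in> Q" for i' using that by blast
  have QO: "Q \<subseteq> \<Omega> a b" using Q by (simp add: parity_check_def)
  then have "j \<in> {1..b}" using ij by auto
  then have "col_vec a j \<in> C0 a b" unfolding C0_def by (intro F2.span_base) auto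
  then have "(\<Sum>\<omega>\<in>Q. col_vec a j \<omega>) = 0" using Q by (auto simp: parity_check_def)
  moreover have "(\<Sum>\<omega>\<in>Q. col_vec a j \<omega>) = (\<Sum>\<omega>\<in>Q. if \<omega> = (i, j) then 1 else 0)"
  proof (rule sum.cong)
    fix \<omega> assume "\<omega> \<in> Q"
    moreover from this have "\<omega> \<in> \<Omega> a b" using QO by blast
    ultimately show "col_vec a j \<omega> = (if \<omega> = (i, j) then 1 else 0)"
      using only by (cases \<omega>) (auto simp: col_vec_apply)
  qed simp
  moreover have "finite Q" using QO finite_\<Omega> by (rule finite_subset)
  ultimately show False
    using ij by simp
qed

section \<open>Automorphisms as symmetries of the grid\<close>

text \<open>Adjacency, or equality, in the rook's graph of the grid.\<close>

definition aligned :: "nat \<times> nat \<Rightarrow> nat \<times> nat \<Rightarrow> bool" where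
  "aligned x y \<longleftrightarrow> fst x = fst y \<or> snd x = snd y"

text \<open>
  Each of the two given cells needs a partner in its row and one in its column. The partners of
  \<open>(i, j)\<close> already fill up the four places, so they have to serve \<open>(i', j')\<close> too, which puts
  them on the remaining corners of the rectangle.
\<close>

lemma parity_check_four_unaligned:
  assumes Q: "parity_check a b Q" "card Q = 4" and "(i, j) \<in> Q" "(i', j') \<in> Q" "i \<noteq> i'" "j \<noteq> j'"
  shows "Q = {(i, j), (i', j'), (i, j'), (i', j)}"
proof -
  have fin: "finite Q" using Q(2) card.infinite by fastforce
  obtain c where c: "(i, c) \<in> Q" "c \<noteq> j" using parity_check_other_in_row[OF Q(1) assms(3)] by blast
  obtain r where r: "(r, j) \<in> Q" "r \<noteq> i" using parity_check_other_in_column[OF Q(1) assms(3)] by blast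
  have Q_eq: "Q = {(i, j), (i', j'), (i, c), (r, j)}"
    using assms c r fin by (intro card_subset_eq[symmetric]) auto
  obtain c' where "(i', c') \<in> Q" "c' \<noteq> j'" using parity_check_other_in_row[OF Q(1) assms(4)] by blast
  then have "r = i'" using Q_eq assms(5) by auto
  obtain r' where "(r', j') \<in> Q" "r' \<noteq> i'" using parity_check_other_in_column[OF Q(1) assms(4)] by blast
  then have "c = j'" using Q_eq assms(6) by auto
  with Q_eq \<open>r = i'\<close> show ?thesis by auto
qed

lemma obtain_two_others:
  fixes i :: nat
  assumes "3 \<le> n"
  obtains k l where "k \<in> {1..n}" "l \<in> {1..n}" "k \<noteq> l" "k \<noteq> i" "l \<noteq> i"
proof -
  have "1 < card ({1..n} - {i})"
    using assms card_Diff1_le[of "{1..n}" i] by (auto simp: card_Diff_singleton_if)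
  then obtain k l where "k \<in> {1..n} - {i}" "l \<in> {1..n} - {i}" "k \<noteq> l"
    by (metis One_nat_def card_le_Suc0_iff_eq finite_Diff finite_atLeastAtMost not_le)
  then show ?thesis using that by auto
qed

text \<open>
  Alignment in terms of the dual code alone, which makes it an invariant of automorphisms. Two cells
  of a line lie on one rectangle for each further parallel line, and the bounds on \<open>a\<close> and \<open>b\<close>
  provide at least two of those.
\<close>

lemma aligned_iff_two_parity_checks:
  assumes "3 \<le> a" "3 \<le> b" "x \<in> \<Omega> a b" "y \<in> \<Omega> a b" "x \<noteq> y"
  shows "aligned x y \<longleftrightarrow> (\<exists>Q R. Q \<noteq> R \<and> parity_check a b Q \<and> parity_check a b R \<and>
    card Q = 4 \<and> card R = 4 \<and> {x, y} \<subseteq> Q \<and> {x, y} \<subseteq> R)" (is "_ \<longleftrightarrow> ?two")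
proof
  obtain i j i' j' where xy: "x = (i, j)" "y = (i', j')" by fastforce
  assume "aligned x y"
  then consider "i = i'" "j \<noteq> j'" | "i \<noteq> i'" "j = j'"
    using assms(5) by (auto simp: aligned_def xy)
  then show ?two
  proof cases
    case 1
    obtain k l where kl: "k \<in> {1..a}" "l \<in> {1..a}" "k \<noteq> l" "k \<noteq> i" "l \<noteq> i"
      using obtain_two_others[OF assms(1)] .
    let ?R = "\<lambda>k. {(i, j), (i, j'), (k, j), (k, j')}"
    define Q R where QR: "Q = ?R k" "R = ?R l"
    have "parity_check a b Q" "parity_check a b R"
      unfolding QR using 1 kl assms(3,4) by (simp_all add: xy parity_check_rectangle)
    moreover have "(k, j) \<in> Q" "(k, j) \<notin> R" unfolding QR using kl by simp_all
    moreover have "card Q = 4" "card R = 4" unfolding QR using kl 1 by simp_all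
    moreover have "{x, y} \<subseteq> Q" "{x, y} \<subseteq> R" unfolding QR using 1 by (simp_all add: xy)
    ultimately show ?two by metis
  next
    case 2
    obtain k l where kl: "k \<in> {1..b}" "l \<in> {1..b}" "k \<noteq> l" "k \<noteq> j" "l \<noteq> j"
      using obtain_two_others[OF assms(2)] .
    let ?R = "\<lambda>k. {(i, j), (i, k), (i', j), (i', k)}"
    define Q R where QR: "Q = ?R k" "R = ?R l"
    have "parity_check a b Q" "parity_check a b R"
      unfolding QR using 2 kl assms(3,4) by (simp_all add: xy parity_check_rectangle)
    moreover have "(i, k) \<in> Q" "(i, k) \<notin> R" unfolding QR using kl by simp_all
    moreover have "card Q = 4" "card R = 4" unfolding QR using kl 2 by simp_all
    moreover have "{x, y} \<subseteq> Q" "{x, y} \<subseteq> R" unfolding QR using 2 by (simp_all add: xy)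
    ultimately show ?two by metis
  qed
next
  obtain i j i' j' where xy: "x = (i, j)" "y = (i', j')" by fastforce
  assume ?two
  then show "aligned x y"
    using parity_check_four_unaligned[of a b _ i j i' j'] by (auto simp: aligned_def xy)
qed

lemma Aut_preserves_aligned:
  assumes ab: "3 \<le> a" "3 \<le> b"
    and h: "h \<in> Aut a b (C0 a b)" and g: "g \<in> Aut a b (C0 a b)"
    and gh: "\<And>x. x \<in> \<Omega> a b \<Longrightarrow> g (h x) = x"
    and xy: "x \<in> \<Omega> a b" "y \<in> \<Omega> a b" "aligned x y"
  shows "aligned (h x) (h y)"
proof (cases "x = y")
  case False
  have hb: "bij_betw h (\<Omega> a b) (\<Omega> a b)" using h by (auto simp: Aut_def Bij_def)
  obtain Q R where QR: "Q \<noteq> R" "parity_check a b Q" "parity_check a b R"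
    "card Q = 4" "card R = 4" "{x, y} \<subseteq> Q" "{x, y} \<subseteq> R"
    using aligned_iff_two_parity_checks[OF ab xy(1,2) False] xy(3) by blast
  have sub: "Q \<subseteq> \<Omega> a b" "R \<subseteq> \<Omega> a b" using QR by (auto simp: parity_check_def)
  have inj: "inj_on h (\<Omega> a b)" using hb by (simp add: bij_betw_def)
  have "card (h ` Q) = 4" "card (h ` R) = 4"
    using card_image[OF inj_on_subset[OF inj]] sub QR by auto
  moreover have "h ` Q \<noteq> h ` R"
    using inj_on_image_eq_iff[OF inj sub] QR(1) by simp
  moreover have "parity_check a b (h ` Q)" "parity_check a b (h ` R)"
    using parity_check_image[OF h g gh] QR by auto
  moreover have "h x \<in> \<Omega> a b" "h y \<in> \<Omega> a b" "h x \<noteq> h y"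
    using hb xy False by (auto simp: bij_betw_def inj_on_def)
  moreover have "{h x, h y} \<subseteq> h ` Q" "{h x, h y} \<subseteq> h ` R" using QR(6,7) by auto
  ultimately show ?thesis
    using aligned_iff_two_parity_checks[OF ab, of "h x" "h y"] by metis
qed (simp add: aligned_def)

text \<open>If \<open>x\<close> and \<open>y\<close> are in different rows, they share a column, and a cell off that column would have
  to be in the rows of both.\<close>

lemma pairwise_aligned_in_line:
  assumes "\<And>x y. x \<in> S \<Longrightarrow> y \<in> S \<Longrightarrow> aligned x y"
  shows "(\<exists>i. \<forall>x\<in>S. fst x = i) \<or> (\<exists>j. \<forall>x\<in>S. snd x = j)"
proof (rule ccontr)
  assume no: "\<not> ?thesis"
  then obtain x y where xy: "x \<in> S" "y \<in> S" "fst x \<noteq> fst y" by metis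
  obtain z where z: "z \<in> S" "snd z \<noteq> snd x" using no by metis
  show False
    using assms[of x y] assms[of x z] assms[of y z] xy z by (auto simp: aligned_def)
qed

text \<open>
  If two cells of a column had images in one row, that row would be the image of the whole row of the
  first cell, by counting; but this row contains only one cell of the column.
\<close>

lemma columns_to_columns:
  assumes bij: "bij_betw h (\<Omega> a b) (\<Omega> a b)"
    and al: "\<And>x y. x \<in> \<Omega> a b \<Longrightarrow> y \<in> \<Omega> a b \<Longrightarrow> aligned x y \<Longrightarrow> aligned (h x) (h y)"
    and rows: "\<And>x y. x \<in> \<Omega> a b \<Longrightarrow> y \<in> \<Omega> a b \<Longrightarrow> fst x = fst y \<Longrightarrow> fst (h x) = fst (h y)"
    and x: "x \<in> \<Omega> a b" and y: "y \<in> \<Omega> a b" and xy: "snd x = snd y"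
  shows "snd (h x) = snd (h y)"
proof (rule ccontr)
  assume neq: "snd (h x) \<noteq> snd (h y)"
  have "aligned (h x) (h y)" using al[OF x y] xy by (simp add: aligned_def)
  with neq have same: "fst (h x) = fst (h y)" by (simp add: aligned_def)
  have inj: "inj_on h (\<Omega> a b)" and im: "h ` \<Omega> a b = \<Omega> a b" using bij by (auto simp: bij_betw_def)
  let ?row = "\<lambda>i. {i} \<times> {1..b}"
  have row: "?row (fst x) \<subseteq> \<Omega> a b" using x by (cases x) auto
  have "h ` ?row (fst x) = ?row (fst (h x))"
  proof (rule card_subset_eq)
    show "h ` ?row (fst x) \<subseteq> ?row (fst (h x))"
    proof (rule image_subsetI)
      fix z assume z: "z \<in> ?row (fst x)"
      then have "z \<in> \<Omega> a b" using row by blast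
      moreover from this have "h z \<in> \<Omega> a b" using im by blast
      moreover have "fst z = fst x" using z by auto
      ultimately show "h z \<in> ?row (fst (h x))" using rows[of z x] x by (cases "h z") auto
    qed
    show "card (h ` ?row (fst x)) = card (?row (fst (h x)))"
      using card_image[OF inj_on_subset[OF inj row]] by simp
  qed simp
  moreover have "h y \<in> ?row (fst (h x))"
  proof -
    have "h y \<in> \<Omega> a b" using y im by blast
    then show ?thesis using same by (cases "h y") auto
  qed
  ultimately have "h y \<in> h ` ?row (fst x)" by (simp only:)
  then have "y \<in> ?row (fst x)" using inj_on_image_mem_iff[OF inj y row] by simp
  then have "x = y" using xy by (auto simp: prod_eq_iff)
  then show False using neq by simp
qed

text \<open>
  The image of a row is pairwise aligned, so it lies in a line. If some row goes into a column, then
  \<open>b \<le> a\<close>, and the image is the full column; no other row can go into a row then, since rows and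
  columns meet while the images of distinct rows do not. Hence all rows go to rows, or all go to
  columns; the second case reduces to the first by composing with the transposition of the square grid.
\<close>

lemma grid_automorphism_cases:
  assumes ab: "1 \<le> a" "a \<le> b" and bij: "bij_betw h (\<Omega> a b) (\<Omega> a b)"
    and al: "\<And>x y. x \<in> \<Omega> a b \<Longrightarrow> y \<in> \<Omega> a b \<Longrightarrow> aligned x y \<Longrightarrow> aligned (h x) (h y)"
  obtains (straight) \<sigma> \<tau> where "\<And>i j. (i, j) \<in> \<Omega> a b \<Longrightarrow> h (i, j) = (\<sigma> i, \<tau> j)"
  | (swap) \<sigma> \<tau> where "a = b" "\<And>i j. (i, j) \<in> \<Omega> a b \<Longrightarrow> h (i, j) = (\<tau> j, \<sigma> i)"
proof -
  let ?row = "\<lambda>i. {i} \<times> {1..b}" and ?col = "\<lambda>j. {1..a} \<times> {j}"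
  have inj: "inj_on h (\<Omega> a b)" and im: "h ` \<Omega> a b = \<Omega> a b" using bij by (auto simp: bij_betw_def)
  have row: "?row i \<subseteq> \<Omega> a b" if "i \<in> {1..a}" for i using that by auto
  have card_row: "card (h ` ?row i) = b" if "i \<in> {1..a}" for i
    using card_image[OF inj_on_subset[OF inj row[OF that]]] by simp
  have im_row: "h ` ?row i \<subseteq> \<Omega> a b" if "i \<in> {1..a}" for i
    using im row[OF that] by blast
  have line: "(\<exists>r. \<forall>x\<in>h ` ?row i. fst x = r) \<or> (\<exists>c. \<forall>x\<in>h ` ?row i. snd x = c)"
    if "i \<in> {1..a}" for i
  proof (rule pairwise_aligned_in_line)
    fix u w assume "u \<in> h ` ?row i" "w \<in> h ` ?row i"
    then obtain j j' where "u = h (i, j)" "w = h (i, j')" "j \<in> {1..b}" "j' \<in> {1..b}"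
      by auto
    then show "aligned u w" using al[of "(i, j)" "(i, j')"] that by (simp add: aligned_def)
  qed
  show thesis
  proof (cases "\<forall>i\<in>{1..a}. \<exists>r. \<forall>x\<in>h ` ?row i. fst x = r")
    case True
    have rows: "fst (h x) = fst (h y)" if in_row: "x \<in> \<Omega> a b" "y \<in> \<Omega> a b" "fst x = fst y" for x y
    proof -
      obtain i j j' where xy: "x = (i, j)" "y = (i, j')" using in_row(3) by (cases x; cases y) auto
      then have i: "i \<in> {1..a}" and im: "h x \<in> h ` ?row i" "h y \<in> h ` ?row i"
        using in_row by auto
      obtain r where "\<forall>x\<in>h ` ?row i. fst x = r" using bspec[OF True i] by blast
      from bspec[OF this im(1)] bspec[OF this im(2)] show ?thesis by simp
    qed
    note cols = columns_to_columns[OF bij al rows]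
    show thesis
    proof (rule straight)
      fix i j assume "(i, j) \<in> \<Omega> a b"
      then have "fst (h (i, j)) = fst (h (i, 1))" "snd (h (i, j)) = snd (h (1, j))"
        using ab by (intro rows cols; simp)+
      then show "h (i, j) = (fst (h (i, 1)), snd (h (1, j)))"
        by (cases "h (i, j)") simp
    qed
  next
    case False
    then obtain k where k: "k \<in> {1..a}" "\<nexists>r. \<forall>x\<in>h ` ?row k. fst x = r" by blast
    then obtain c where c: "\<forall>x\<in>h ` ?row k. snd x = c" using line by blast
    have sub: "h ` ?row k \<subseteq> ?col c"
    proof
      fix z assume "z \<in> h ` ?row k"
      with im_row[OF k(1)] c have "z \<in> \<Omega> a b" "snd z = c" by blast+
      then show "z \<in> ?col c" by (cases z) simp
    qed
    have "b \<le> a" using card_mono[OF _ sub] card_row[OF k(1)] by simp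
    then have eq: "a = b" using ab by simp
    have full: "h ` ?row k = ?col c"
      using sub card_row[OF k(1)] eq by (intro card_subset_eq) auto
    have not_row: "\<exists>c. \<forall>x\<in>h ` ?row i. snd x = c" if i: "i \<in> {1..a}" for i
    proof (rule ccontr)
      assume "\<not> ?thesis"
      then obtain r where r: "\<forall>x\<in>h ` ?row i. fst x = r" using line[OF i] by blast
      then have "i \<noteq> k" using k(2) by auto
      have "h ` ?row i \<subseteq> ?row r"
      proof
        fix z assume "z \<in> h ` ?row i"
        with im_row[OF i] r have "z \<in> \<Omega> a b" "fst z = r" by blast+
        then show "z \<in> ?row r" by (cases z) simp
      qed
      then have "h ` ?row i = ?row r" using card_row[OF i] by (intro card_subset_eq) auto
      moreover have "h ` ?row k \<inter> h ` ?row i = {}"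
        using \<open>i \<noteq> k\<close> inj_on_image_Int[OF inj row[OF k(1)] row[OF i]] by auto
      moreover have "(r, c) \<in> ?col c \<inter> ?row r"
      proof -
        have "h (i, 1) \<in> \<Omega> a b" "fst (h (i, 1)) = r" using im_row[OF i] r ab by auto
        moreover have "h (k, 1) \<in> \<Omega> a b" "snd (h (k, 1)) = c" using im_row[OF k(1)] c ab by auto
        ultimately show ?thesis by (cases "h (i, 1)"; cases "h (k, 1)") auto
      qed
      ultimately show False unfolding full by blast
    qed
    define s where "s = prod.swap \<circ> h"
    have "bij_betw prod.swap (\<Omega> a b) (\<Omega> a b)"
      unfolding eq by (auto simp: bij_betw_def \<Omega>_def inj_on_def)
    then have bij': "bij_betw s (\<Omega> a b) (\<Omega> a b)"
      unfolding s_def using bij by (rule bij_betw_trans[rotated])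
    have al': "aligned (s x) (s y)" if "x \<in> \<Omega> a b" "y \<in> \<Omega> a b" "aligned x y" for x y
      using al[OF that] by (auto simp: s_def aligned_def)
    have rows: "fst (s x) = fst (s y)" if in_row: "x \<in> \<Omega> a b" "y \<in> \<Omega> a b" "fst x = fst y" for x y
    proof -
      obtain i j j' where xy: "x = (i, j)" "y = (i, j')" using in_row(3) by (cases x; cases y) auto
      then have i: "i \<in> {1..a}" and im: "h x \<in> h ` ?row i" "h y \<in> h ` ?row i"
        using in_row by auto
      obtain c where "\<forall>x\<in>h ` ?row i. snd x = c" using not_row[OF i] by blast
      from bspec[OF this im(1)] bspec[OF this im(2)] show ?thesis by (simp add: s_def)
    qed
    note cols = columns_to_columns[OF bij' al' rows]
    show thesis
    proof (rule swap[OF eq])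
      fix i j assume "(i, j) \<in> \<Omega> a b"
      then have "fst (s (i, j)) = fst (s (i, 1))" "snd (s (i, j)) = snd (s (1, j))"
        using ab by (intro rows cols; simp)+
      then show "h (i, j) = (fst (h (1, j)), snd (h (i, 1)))"
        by (cases "h (i, j)") (simp add: s_def)
    qed
  qed
qed

section \<open>Transitive grid automorphisms\<close>

text \<open>Transitivity on cells makes \<open>\<sigma>\<close> and \<open>\<tau>\<close> transitive on rows and columns, hence cycles of lengths
  \<open>a\<close> and \<open>b\<close>. After \<open>lcm a b\<close> steps the cell \<open>(1, 1)\<close> has returned, so \<open>a * b \<le> lcm a b\<close>.\<close>

lemma coprime_if_product_transitive:
  assumes ab: "1 \<le> a" "1 \<le> b" and bij: "bij_betw h (\<Omega> a b) (\<Omega> a b)"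
    and h: "\<And>i j. (i, j) \<in> \<Omega> a b \<Longrightarrow> h (i, j) = (\<sigma> i, \<tau> j)"
    and trans: "\<And>y. y \<in> \<Omega> a b \<Longrightarrow> \<exists>k. (h ^^ k) (1, 1) = y"
  shows "gcd a b = 1"
proof -
  have im: "h x \<in> \<Omega> a b" if "x \<in> \<Omega> a b" for x using bij that by (auto simp: bij_betw_def)
  have inj: "x = y" if "x \<in> \<Omega> a b" "y \<in> \<Omega> a b" "h x = h y" for x y
    using bij that by (auto simp: bij_betw_def inj_on_def)
  have s_im: "\<sigma> ` {1..a} \<subseteq> {1..a}" using im[of "(_, 1)"] h ab by fastforce
  have t_im: "\<tau> ` {1..b} \<subseteq> {1..b}" using im[of "(1, _)"] h ab by fastforce
  have s_inj: "inj_on \<sigma> {1..a}"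
    using inj[of "(_, 1)" "(_, 1)"] h ab by (auto simp: inj_on_def)
  have t_inj: "inj_on \<tau> {1..b}"
    using inj[of "(1, _)" "(1, _)"] h ab by (auto simp: inj_on_def)
  have s1: "(\<sigma> ^^ k) 1 \<in> {1..a}" for k using s_im ab by (intro funpow_mem) auto
  have t1: "(\<tau> ^^ k) 1 \<in> {1..b}" for k using t_im ab by (intro funpow_mem) auto
  have pow: "(h ^^ k) (1, 1) = ((\<sigma> ^^ k) 1, (\<tau> ^^ k) 1)" for k
    by (induction k) (use h s1 t1 in auto)
  have s_trans: "\<exists>k. (\<sigma> ^^ k) 1 = i" if "i \<in> {1..a}" for i
    using trans[of "(i, 1)", unfolded pow] that ab by auto
  have t_trans: "\<exists>k. (\<tau> ^^ k) 1 = j" if "j \<in> {1..b}" for j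
    using trans[of "(1, j)", unfolded pow] that ab by auto
  have s_per: "(\<sigma> ^^ a) 1 = 1"
  proof -
    obtain d where d: "0 < d" "d \<le> a" "(\<sigma> ^^ d) 1 = 1"
      using inj_on_returns[OF _ s_im s_inj, of 1] ab by auto
    with orbit_card_le_period[OF d(1,3), of "{1..a}"] s_trans show ?thesis by simp
  qed
  have t_per: "(\<tau> ^^ b) 1 = 1"
  proof -
    obtain d where d: "0 < d" "d \<le> b" "(\<tau> ^^ d) 1 = 1"
      using inj_on_returns[OF _ t_im t_inj, of 1] ab by auto
    with orbit_card_le_period[OF d(1,3), of "{1..b}"] t_trans show ?thesis by simp
  qed
  have "a dvd lcm a b" "b dvd lcm a b" by simp_all
  then obtain m n where mn: "lcm a b = a * m" "lcm a b = b * n" unfolding dvd_def by blast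
  have "(h ^^ lcm a b) (1, 1) = (1, 1)"
    using funpow_mult_fixed[OF s_per, of m] funpow_mult_fixed[OF t_per, of n] mn pow by simp
  moreover have pos: "0 < lcm a b" using ab by (simp add: lcm_pos_nat)
  ultimately have "card (\<Omega> a b) \<le> lcm a b"
    using trans by (intro orbit_card_le_period)
  then have "gcd a b * lcm a b \<le> 1 * lcm a b"
    by (simp add: prod_gcd_lcm_nat[symmetric])
  then have "gcd a b \<le> 1" using pos by (simp only: mult_le_cancel2)
  moreover have "0 < gcd a b" using ab by simp
  ultimately show ?thesis by linarith
qed

text \<open>
  The square of \<open>h\<close> acts on rows by \<open>\<tau> \<circ> \<sigma>\<close> and on columns by \<open>\<sigma> \<circ> \<tau>\<close>, which \<open>\<sigma>\<close> conjugates into each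
  other. So it maps \<open>(i, \<sigma> i)\<close> to a cell of the same form, and under it \<open>(1, \<sigma> 1)\<close> returns as
  soon as the row \<open>1\<close> does.
\<close>

lemma le_2_if_swap_transitive:
  assumes a: "1 \<le> a" and bij: "bij_betw h (\<Omega> a a) (\<Omega> a a)"
    and h: "\<And>i j. (i, j) \<in> \<Omega> a a \<Longrightarrow> h (i, j) = (\<tau> j, \<sigma> i)"
    and trans: "\<And>x y. x \<in> \<Omega> a a \<Longrightarrow> y \<in> \<Omega> a a \<Longrightarrow> \<exists>k. (h ^^ k) x = y"
  shows "a \<le> 2"
proof -
  have im: "h x \<in> \<Omega> a a" if "x \<in> \<Omega> a a" for x using bij that by (auto simp: bij_betw_def)
  have inj: "x = y" if "x \<in> \<Omega> a a" "y \<in> \<Omega> a a" "h x = h y" for x y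
    using bij that by (auto simp: bij_betw_def inj_on_def)
  have s_im: "\<sigma> i \<in> {1..a}" if "i \<in> {1..a}" for i using im[of "(i, 1)"] h[of i 1] a that by simp
  have t_im: "\<tau> j \<in> {1..a}" if "j \<in> {1..a}" for j using im[of "(1, j)"] h[of 1 j] a that by simp
  have s_inj: "i = i'" if "i \<in> {1..a}" "i' \<in> {1..a}" "\<sigma> i = \<sigma> i'" for i i'
    using inj[of "(i, 1)" "(i', 1)"] h[of i 1] h[of i' 1] a that by simp
  have t_inj: "j = j'" if "j \<in> {1..a}" "j' \<in> {1..a}" "\<tau> j = \<tau> j'" for j j'
    using inj[of "(1, j)" "(1, j')"] h[of 1 j] h[of 1 j'] a that by simp
  define s where "s = (\<lambda>i. \<tau> (\<sigma> i))"
  have "inj_on s {1..a}"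
    unfolding inj_on_def s_def using s_inj t_inj s_im by blast
  moreover have s_maps: "s ` {1..a} \<subseteq> {1..a}"
    unfolding s_def image_subset_iff using s_im t_im by blast
  ultimately obtain d where d: "0 < d" "d \<le> a" "(s ^^ d) 1 = 1"
    using inj_on_returns[of "{1..a}" s 1] a by auto
  have mem: "(s ^^ k) 1 \<in> {1..a}" for k
    using s_maps a by (intro funpow_mem) auto
  have h2: "h (h (i, \<sigma> i)) = (s i, \<sigma> (s i))" if "i \<in> {1..a}" for i
  proof -
    have "h (i, \<sigma> i) = (s i, \<sigma> i)" using h[of i "\<sigma> i"] that s_im by (simp add: s_def)
    moreover have "h (s i, \<sigma> i) = (s i, \<sigma> (s i))"
      using h[of "s i" "\<sigma> i"] that s_im t_im by (simp add: s_def)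
    ultimately show ?thesis by simp
  qed
  have pow: "(h ^^ (2 * k)) (1, \<sigma> 1) = ((s ^^ k) 1, \<sigma> ((s ^^ k) 1))" for k
  proof (induction k)
    case (Suc k)
    have "(h ^^ (2 * Suc k)) (1, \<sigma> 1) = h (h ((h ^^ (2 * k)) (1, \<sigma> 1)))" by simp
    also have "\<dots> = (s ((s ^^ k) 1), \<sigma> (s ((s ^^ k) 1)))"
      unfolding Suc.IH by (rule h2[OF mem])
    finally show ?case by simp
  qed simp
  have "card (\<Omega> a a) \<le> 2 * d"
  proof (rule orbit_card_le_period)
    show "(h ^^ (2 * d)) (1, \<sigma> 1) = (1, \<sigma> 1)" using pow[of d] d(3) by simp
    show "\<exists>k. (h ^^ k) (1, \<sigma> 1) = y" if "y \<in> \<Omega> a a" for y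
      using trans[of "(1, \<sigma> 1)"] that s_im[of 1] a by simp
  qed (use d in simp)
  also have "\<dots> \<le> 2 * a" using d(2) by simp
  finally show ?thesis using a by simp
qed

lemma coprime_if_cyclic_code:
  assumes ab: "3 \<le> a" "a \<le> b" and cyc: "cyclic_code a b (C0 a b)"
  shows "gcd a b = 1"
proof -
  have one: "(1, 1) \<in> \<Omega> a b" using ab by simp
  obtain h g where h: "h \<in> Aut a b (C0 a b)" and g: "g \<in> Aut a b (C0 a b)"
    and gh: "\<And>x. x \<in> \<Omega> a b \<Longrightarrow> g (h x) = x"
    and trans: "\<And>x y. x \<in> \<Omega> a b \<Longrightarrow> y \<in> \<Omega> a b \<Longrightarrow> \<exists>k. (h ^^ k) x = y"
    using cyclic_codeE[OF cyc] by metis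
  have bij: "bij_betw h (\<Omega> a b) (\<Omega> a b)" using h by (auto simp: Aut_def Bij_def)
  have al: "aligned (h x) (h y)" if "x \<in> \<Omega> a b" "y \<in> \<Omega> a b" "aligned x y" for x y
    using ab that by (intro Aut_preserves_aligned[OF _ _ h g gh]) auto
  show ?thesis
  proof (rule grid_automorphism_cases[OF _ ab(2) bij al])
    show "1 \<le> a" using ab by simp
  next
    fix \<sigma> \<tau> assume "\<And>i j. (i, j) \<in> \<Omega> a b \<Longrightarrow> h (i, j) = (\<sigma> i, \<tau> j)"
    then show ?thesis
      using coprime_if_product_transitive[OF _ _ bij, of \<sigma> \<tau>] trans[OF one] ab by simp
  next
    fix \<sigma> \<tau> assume "a = b" "\<And>i j. (i, j) \<in> \<Omega> a b \<Longrightarrow> h (i, j) = (\<tau> j, \<sigma> i)"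
    then show ?thesis
      using le_2_if_swap_transitive[of a h \<tau> \<sigma>] bij trans ab by simp
  qed
qed

section \<open>Cyclic automorphisms for coprime sizes and for two rows\<close>

lemma bij_betw_cycle: "bij_betw (\<lambda>i :: nat. i mod n + 1) {1..n} {1..n}"
proof -
  have "inj_on (\<lambda>i :: nat. i mod n + 1) {1..n}"
  proof (rule inj_onI)
    fix i j :: nat assume "i \<in> {1..n}" "j \<in> {1..n}" "i mod n + 1 = j mod n + 1"
    moreover have "k mod n = (if k = n then 0 else k)" if "k \<in> {1..n}" for k :: nat
      using that by auto
    ultimately show "i = j" by (auto split: if_splits)
  qed
  moreover have "(\<lambda>i :: nat. i mod n + 1) ` {1..n} \<subseteq> {1..n}"
    by (auto simp: Suc_le_eq)
  ultimately show ?thesis by (simp add: bij_betw_def endo_inj_surj)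
qed

text \<open>Stating the hypothesis at the image cells avoids the inverse of \<open>h\<close>.\<close>

lemma perm_map_mem_C0I:
  assumes "bij_betw h (\<Omega> a b) (\<Omega> a b)"
    and "\<And>i j. (i, j) \<in> \<Omega> a b \<Longrightarrow> v (i, j) = x (fst (h (i, j))) + y (snd (h (i, j)))"
  shows "perm_map a b h v \<in> C0 a b"
  unfolding C0_iff
proof (intro conjI exI allI impI)
  fix i j assume "(i, j) \<in> \<Omega> a b"
  then obtain i' j' where "(i', j') \<in> \<Omega> a b" "h (i', j') = (i, j)"
    using assms(1) by (metis bij_betw_imp_surj_on imageE surj_pair)
  then show "perm_map a b h v (i, j) = x i + y j"
    using perm_map_apply[OF assms(1), of "(i', j')" v] assms(2)[of i' j'] by simp
qed (rule perm_map_in_Mat[OF assms(1)])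

lemma cyclic_code_if_coprime:
  assumes ab: "1 \<le> a" "1 \<le> b" and "coprime a b"
  shows "cyclic_code a b (C0 a b)"
proof (rule cyclic_codeI)
  define c where "c = (\<lambda>n i :: nat. i mod n + 1)"
  let ?h = "map_prod (c a) (c b)"
  show bij: "bij_betw ?h (\<Omega> a b) (\<Omega> a b)"
    unfolding \<Omega>_def c_def by (intro bij_betw_map_prod bij_betw_cycle)
  show "perm_map a b ?h ` C0 a b \<subseteq> C0 a b"
  proof (rule image_subsetI)
    fix v assume "v \<in> C0 a b"
    then obtain x y where v: "\<And>i j. (i, j) \<in> \<Omega> a b \<Longrightarrow> v (i, j) = x i + y j"
      by (auto simp: C0_iff)
    have inv: "inv_into {1..n} (c n) (c n i) = i" if "i \<in> {1..n}" for n i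
      using bij_betw_cycle[of n] that unfolding c_def by (intro inv_into_f_f) (auto simp: bij_betw_def)
    show "perm_map a b ?h v \<in> C0 a b"
      using inv v
      by (intro perm_map_mem_C0I[OF bij, where x = "x \<circ> inv_into {1..a} (c a)"
            and y = "y \<circ> inv_into {1..b} (c b)"]) auto
  qed
  show "C0 a b \<subseteq> Mat a b" by (rule C0_subset_Mat)
  show "(1, 1) \<in> \<Omega> a b" using ab by simp
  fix y assume y: "y \<in> \<Omega> a b"
  obtain i j where ij: "y = (i, j)" by fastforce
  have pow: "(?h ^^ k) (1, 1) = (k mod a + 1, k mod b + 1)" for k
    by (induction k) (auto simp: c_def mod_Suc_eq)
  obtain k where k: "[k = i - 1] (mod a)" "[k = j - 1] (mod b)"
    using binary_chinese_remainder_nat[OF assms(3)] by blast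
  then have "(?h ^^ k) (1, 1) = y"
    using y ab unfolding pow by (auto simp: ij cong_def)
  then show "\<exists>k. (?h ^^ k) (1, 1) = y" ..
qed

lemma cyclic_code_two_rows:
  assumes b: "1 \<le> b"
  shows "cyclic_code 2 b (C0 2 b)"
proof (rule cyclic_codeI)
  define h :: "nat \<times> nat \<Rightarrow> nat \<times> nat"
    where "h = (\<lambda>(i, j). if j < b then (i, j + 1) else (3 - i, 1))"
  have "inj_on h (\<Omega> 2 b)"
    by (auto simp: inj_on_def h_def \<Omega>_def split: if_splits)
  moreover have "h ` \<Omega> 2 b \<subseteq> \<Omega> 2 b"
    using b by (intro image_subsetI) (auto simp: h_def \<Omega>_def)
  ultimately show bij: "bij_betw h (\<Omega> 2 b) (\<Omega> 2 b)"
    by (simp add: bij_betw_def endo_inj_surj)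
  show "perm_map 2 b h ` C0 2 b \<subseteq> C0 2 b"
  proof (rule image_subsetI)
    fix v assume "v \<in> C0 2 b"
    then obtain x y where v: "\<And>i j. (i, j) \<in> \<Omega> 2 b \<Longrightarrow> v (i, j) = x i + y j"
      by (auto simp: C0_iff)
    (* The column that wraps around to position 1 has its entries exchanged, as x 1 + x 2 added to
       both of them does. *)
    define y' where "y' = (\<lambda>j. if j = 1 then y b + x 1 + x 2 else y (j - 1))"
    have two: "i = 1 \<or> i = 2" if "i \<in> {1..2}" for i :: nat using that by auto
    have "v (i, j) = x (fst (h (i, j))) + y' (snd (h (i, j)))" if "(i, j) \<in> \<Omega> 2 b" for i j
      using v[OF that] two[of i] that by (auto simp: h_def y'_def ac_simps)
    then show "perm_map 2 b h v \<in> C0 2 b"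
      by (rule perm_map_mem_C0I[OF bij])
  qed
  show "C0 2 b \<subseteq> Mat 2 b" by (rule C0_subset_Mat)
  show "(1, 1) \<in> \<Omega> 2 b" using b by simp
  fix y assume y: "y \<in> \<Omega> 2 b"
  obtain i j where ij: "y = (i, j)" by fastforce
  have pow1: "(h ^^ k) (i, 1) = (i, k + 1)" if "k < b" for k i
    using that by (induction k) (auto simp: h_def)
  have "(h ^^ b) (1, 1) = h ((h ^^ (b - 1)) (1, 1))"
    using b by (cases b) auto
  then have powb: "(h ^^ b) (1, 1) = (2, 1)"
    using pow1[of "b - 1"] b by (simp add: h_def)
  from y ij consider "i = 1" | "i = 2" by fastforce
  then show "\<exists>k. (h ^^ k) (1, 1) = y"
  proof cases
    case 1
    then show ?thesis using pow1[of "j - 1"] y by (intro exI[of _ "j - 1"]) (auto simp: ij)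
  next
    case 2
    have "(h ^^ (j - 1 + b)) (1, 1) = (h ^^ (j - 1)) (2, 1)"
      unfolding funpow_add comp_apply powb ..
    then have "(h ^^ (j - 1 + b)) (1, 1) = y"
      using pow1[of "j - 1" 2] y 2 by (auto simp: ij)
    then show ?thesis ..
  qed
qed

theorem corollary3p3:
  fixes a b :: nat
  assumes "a \<ge> 1" and "b \<ge> 1" and "a \<le> b"
  shows "cyclic_code a b (C0 a b) \<longleftrightarrow> a \<in> {1, 2} \<or> gcd a b = 1"
proof
  assume "cyclic_code a b (C0 a b)"
  then show "a \<in> {1, 2} \<or> gcd a b = 1"
    using coprime_if_cyclic_code[of a b] assms by (cases "3 \<le> a") auto
next
  assume "a \<in> {1, 2} \<or> gcd a b = 1"
  then consider "a = 2" | "coprime a b" by (auto simp: coprime_iff_gcd_eq_1)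
  then show "cyclic_code a b (C0 a b)"
    using cyclic_code_two_rows cyclic_code_if_coprime assms by cases auto
qed

end
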